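(* Consider only finite simple graphs that are neither complete nor edgeless, and let $\mathcal{R}_{CVR},\mathcal{R}_{UVR},\mathcal{R}_{CER},\mathcal{R}_{UER},\mathcal{R}_{CEA},\mathcal{R}_{UEA}$ denote the corresponding classes of such graphs (defined in the context). Then the six classes are related as follows. (1) $\mathcal{R}_{CEA}\cup\mathcal{R}_{CVR}\subseteq\mathcal{R}_{UER}$. (2) $\mathcal{R}_{UVR}\subseteq\mathcal{R}_{UEA}$. (3) $\mathcal{R}_{UER}\cap\mathcal{R}_{CER}=\emptyset$, $\mathcal{R}_{UVR}\cap\mathcal{R}_{CVR}=\emptyset$, $\mathcal{R}_{UEA}\cap\mathcal{R}_{CEA}=\emptyset$ and $\mathcal{R}_{CVR}\cap\mathcal{R}_{UEA}=\emptyset$. (4) Each of the following eleven regions is nonempty: $R_1=\mathcal{R}_{UEA}\setminus(\mathcal{R}_{UVR}\cup\mathcal{R}_{UER}\cup\mathcal{R}_{CER})$; $R_2=\mathcal{R}_{UVR}\setminus(\mathcal{R}_{UER}\cup\mathcal{R}_{CER})$; $R_3=(\mathcal{R}_{UEA}\cap\mathcal{R}_{UER})\setminus\mathcal{R}_{UVR}$; $R_4=\mathcal{R}_{UVR}\cap\mathcal{R}_{UER}$; $R_5=\mathcal{R}_{UVR}\cap\mathcal{R}_{CER}$; $R_6=(\mathcal{R}_{UEA}\cap\mathcal{R}_{CER})\setminus\mathcal{R}_{UVR}$; $R_7=\mathcal{R}_{UER}\setminus(\mathcal{R}_{UEA}\cup\mathcal{R}_{CVR}\cup\mathcal{R}_{CEA})$;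 $R_8=\mathcal{R}_{CVR}\setminus\mathcal{R}_{CEA}$; $R_9=\mathcal{R}_{CVR}\cap\mathcal{R}_{CEA}$; $R_{10}=\mathcal{R}_{CEA}\setminus\mathcal{R}_{CVR}$; $R_{11}=\mathcal{R}_{CER}\setminus\mathcal{R}_{UEA}$.
   Context: Graphs are finite, undirected, without loops or multiple edges. A Roman dominating function (RD-function) on a graph $G$ is a map $f:V(G)\to\{0,1,2\}$ such that every vertex with label $0$ has a neighbor with label $2$. Its weight is $\sum_{v\in V(G)}f(v)$, and $\gamma_R(G)$ is the minimum weight of an RD-function on $G$. $\overline{G}$ denotes the complement of $G$. Classes of graphs: $\mathcal{R}_{CVR}$: $\gamma_R(G-v)<\gamma_R(G)$ for every $v\in V(G)$. $\mathcal{R}_{UVR}$: $\gamma_R(G-v)=\gamma_R(G)$ for every $v\in V(G)$. $\mathcal{R}_{CER}$: $\gamma_R(G-e)>\gamma_R(G)$ for every $e\in E(G)$. $\mathcal{R}_{UER}$: $\gamma_R(G-e)=\gamma_R(G)$ for every $e\in E(G)$. $\mathcal{R}_{CEA}$: $\gamma_R(G+e)<\gamma_R(G)$ for every $e\in E(\overline{G})$. $\mathcal{R}_{UEA}$: $\gamma_R(G+e)=\gamma_R(G)$ for every $e\in E(\overline{G})$. *)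

theory Defs
  imports Main
begin

record 'a sgraph =
  verts :: "'a set"
  edges :: "'a set set"

definition all_edges :: "'a set \<Rightarrow> 'a set set" where
  "all_edges V = {{u, v} | u v. u \<in> V \<and> v \<in> V \<and> u \<noteq> v}"

definition simple_graph :: "'a sgraph \<Rightarrow> bool" where
  "simple_graph G \<longleftrightarrow> finite (verts G) \<and> edges G \<subseteq> all_edges (verts G)"

definition compl_graph :: "'a sgraph \<Rightarrow> 'a sgraph" where
  "compl_graph G = \<lparr>verts = verts G, edges = all_edges (verts G) - edges G\<rparr>"

definition complete_graph :: "'a sgraph \<Rightarrow> bool" where
  "complete_graph G \<longleftrightarrow> edges G = all_edges (verts G)"

definition edgeless :: "'a sgraph \<Rightarrow> bool" where
  "edgeless G \<longleftrightarrow> edges G = {}"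

definition del_vert :: "'a sgraph \<Rightarrow> 'a \<Rightarrow> 'a sgraph" where
  "del_vert G v = \<lparr>verts = verts G - {v}, edges = {e \<in> edges G. v \<notin> e}\<rparr>"

definition del_edge :: "'a sgraph \<Rightarrow> 'a set \<Rightarrow> 'a sgraph" where
  "del_edge G e = \<lparr>verts = verts G, edges = edges G - {e}\<rparr>"

definition add_edge :: "'a sgraph \<Rightarrow> 'a set \<Rightarrow> 'a sgraph" where
  "add_edge G e = \<lparr>verts = verts G, edges = insert e (edges G)\<rparr>"

(* Labelings are total HOL functions; only their values on verts G matter. *)
definition rd_function :: "'a sgraph \<Rightarrow> ('a \<Rightarrow> nat) \<Rightarrow> bool" where
  "rd_function G f \<longleftrightarrow>
     f ` verts G \<subseteq> {0, 1, 2} \<and>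
     (\<forall>v \<in> verts G. f v = 0 \<longrightarrow> (\<exists>u \<in> verts G. {u, v} \<in> edges G \<and> f u = 2))"

definition weight :: "'a sgraph \<Rightarrow> ('a \<Rightarrow> nat) \<Rightarrow> nat" where
  "weight G f = (\<Sum>v \<in> verts G. f v)"

(* The constant labeling 1 is always an RD-function, so the minimum exists. *)
definition gamma_R :: "'a sgraph \<Rightarrow> nat" where
  "gamma_R G = (LEAST k. \<exists>f. rd_function G f \<and> weight G f = k)"

definition graphs :: "'a sgraph set" where
  "graphs = {G. simple_graph G \<and> \<not> complete_graph G \<and> \<not> edgeless G}"

definition R_CVR :: "'a sgraph set" where
  "R_CVR = {G \<in> graphs. \<forall>v \<in> verts G. gamma_R (del_vert G v) < gamma_R G}"

definition R_UVR :: "'a sgraph set" where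
  "R_UVR = {G \<in> graphs. \<forall>v \<in> verts G. gamma_R (del_vert G v) = gamma_R G}"

definition R_CER :: "'a sgraph set" where
  "R_CER = {G \<in> graphs. \<forall>e \<in> edges G. gamma_R (del_edge G e) > gamma_R G}"

definition R_UER :: "'a sgraph set" where
  "R_UER = {G \<in> graphs. \<forall>e \<in> edges G. gamma_R (del_edge G e) = gamma_R G}"

definition R_CEA :: "'a sgraph set" where
  "R_CEA = {G \<in> graphs. \<forall>e \<in> edges (compl_graph G). gamma_R (add_edge G e) < gamma_R G}"

definition R_UEA :: "'a sgraph set" where
  "R_UEA = {G \<in> graphs. \<forall>e \<in> edges (compl_graph G). gamma_R (add_edge G e) = gamma_R G}"

end

theory Submission
  imports Defs
begin

text \<open>
  Write \<open>\<gamma>\<close> for \<^const>\<open>gamma_R\<close>. Two observations about minimum weight labellings drive the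
  inclusions. If a vertex \<open>v\<close> is deleted and then restored with label 1, the weight grows by one and
  no edge at \<open>v\<close> is needed; so \<open>\<gamma>(H) \<le> \<gamma>(G - v) + 1\<close> for every \<open>H\<close> that differs from \<open>G\<close> only at
  \<open>v\<close>. If adding an edge \<open>uv\<close> lowers \<open>\<gamma>\<close>, then a cheap labelling must use that edge: one end has
  label 2, the other end has label 0, and the labelling is still valid after deletion of the latter
  (\<open>add_edge_lowering\<close>). The first gives \<open>R_CVR \<subseteq> R_UER\<close>, the second \<open>R_UVR \<subseteq> R_UEA\<close>. Two
  classes with conflicting demands on the same vertices, edges or non-edges are disjoint because each
  of these exists; for \<open>R_CVR\<close> and \<open>R_UEA\<close>, an optimal labelling of \<open>G - u\<close> shows where an edge can be
  added that lowers \<open>\<gamma>\<close> (\<open>CVR_UEA_disjoint\<close>).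

  The inclusion \<open>R_CEA \<subseteq> R_UER\<close> is the hard part. Suppose that every added edge lowers \<open>\<gamma>\<close> but
  that deleting \<open>xy\<close> raises it. Then every optimal labelling uses \<open>xy\<close>: one end has label 2, the other
  has label 0 and no further neighbour with label 2. On the other hand, for every non-edge \<open>uv\<close> some
  optimal labelling puts 2 and 1 on its ends. Playing these off against each other shows that the
  other neighbours of \<open>x\<close> form a clique, likewise those of \<open>y\<close>, and that none of them ever has label 2
  in an optimal labelling; hence any two of them are adjacent. If there is such a
  neighbour, a label 2 can be moved from \<open>x\<close> or \<open>y\<close> to a vertex that does the same work, and the
  result is an optimal labelling of the excluded kind or one that is too cheap. So \<open>x\<close> and \<open>y\<close> have
  no other neighbours, and relabelling both by 1 is optimal without using \<open>xy\<close>, a contradiction.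

  For the eleven regions concrete graphs are given. Their invariants are computed from the formula
  \<open>\<gamma>(G) = min (2 |S| + |V - N[S]|)\<close> over vertex sets \<open>S\<close> (\<open>gamma_R_le_iff\<close>): once the set \<open>S\<close> of
  vertices with label 2 is fixed, exactly the vertices that it does not dominate need a label 1.
\<close>

section \<open>Minimum weight labellings\<close>

lemma gamma_R_le: "rd_function G f \<Longrightarrow> gamma_R G \<le> weight G f"
  unfolding gamma_R_def by (rule Least_le) blast

definition optimal :: "'a sgraph \<Rightarrow> ('a \<Rightarrow> nat) \<Rightarrow> bool" where
  "optimal G f \<longleftrightarrow> rd_function G f \<and> weight G f = gamma_R G"

lemma ex_optimal: "\<exists>f. optimal G f"
proof -
  have "\<exists>f. rd_function G f \<and> weight G f = weight G (\<lambda>_. 1)"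
    by (rule exI[of _ "\<lambda>_. 1"]) (auto simp: rd_function_def)
  then have "\<exists>f. rd_function G f \<and> weight G f = gamma_R G"
    unfolding gamma_R_def by (rule LeastI)
  then show ?thesis unfolding optimal_def .
qed

lemma optimalI: "rd_function G f \<Longrightarrow> weight G f \<le> gamma_R G \<Longrightarrow> optimal G f"
  unfolding optimal_def using gamma_R_le[of G f] by simp

lemma weight_upd:
  assumes "finite (verts G)" "a \<in> verts G"
  shows "weight G (f(a := k)) + f a = weight G f + k"
proof -
  have "(\<Sum>v\<in>verts G - {a}. (f(a := k)) v) = (\<Sum>v\<in>verts G - {a}. f v)"
    by (rule sum.cong) auto
  then show ?thesis
    unfolding weight_def
    using sum.remove[OF assms, of f] sum.remove[OF assms, of "f(a := k)"] by simp
qed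

lemma weight_del_vert:
  assumes "finite (verts G)" "v \<in> verts G"
  shows "weight (del_vert G v) f + f v = weight G f"
  using sum.remove[OF assms, of f] by (simp add: weight_def del_vert_def)

lemma weight_del_edge [simp]: "weight (del_edge G e) f = weight G f"
  by (simp add: weight_def del_edge_def)

lemma weight_add_edge [simp]: "weight (add_edge G e) f = weight G f"
  by (simp add: weight_def add_edge_def)

lemma rd_function_two:
  assumes "rd_function G f" "v \<in> verts G" "f v = 0"
  obtains u where "u \<in> verts G" "{u, v} \<in> edges G" "f u = 2"
  using assms unfolding rd_function_def by blast

lemma rd_function_mono:
  assumes "rd_function G f" "verts H = verts G" "edges G \<subseteq> edges H"
  shows "rd_function H f"
  using assms(1,3) unfolding rd_function_def assms(2) by (meson subsetD)

lemma simple_graph_edgeD: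
  assumes "simple_graph G" "{u, v} \<in> edges G"
  shows "u \<in> verts G" "v \<in> verts G" "u \<noteq> v"
  using assms unfolding simple_graph_def all_edges_def by (auto simp: doubleton_eq_iff)

lemma simple_graph_edgeE:
  assumes "simple_graph G" "e \<in> edges G"
  obtains u v where "e = {u, v}" "u \<in> verts G" "v \<in> verts G" "u \<noteq> v"
  using assms unfolding simple_graph_def all_edges_def by blast

lemma compl_edgeE:
  assumes "e \<in> edges (compl_graph G)"
  obtains u v where "e = {u, v}" "u \<in> verts G" "v \<in> verts G" "u \<noteq> v" "{u, v} \<notin> edges G"
  using assms unfolding compl_graph_def all_edges_def by auto

lemma compl_edgeI:
  assumes "u \<in> verts G" "v \<in> verts G" "u \<noteq> v" "{u, v} \<notin> edges G"
  shows "{u, v} \<in> edges (compl_graph G)"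
  using assms unfolding compl_graph_def all_edges_def by auto

lemma gamma_R_del_edge_ge: "gamma_R G \<le> gamma_R (del_edge G e)"
proof -
  obtain f where f: "optimal (del_edge G e) f" using ex_optimal by blast
  then have "rd_function G f"
    by (intro rd_function_mono[of "del_edge G e" f G]) (auto simp: optimal_def del_edge_def)
  then show ?thesis using f gamma_R_le[of G f] by (simp add: optimal_def)
qed

lemma gamma_R_add_edge_le: "gamma_R (add_edge G e) \<le> gamma_R G"
proof -
  obtain f where f: "optimal G f" using ex_optimal by blast
  then have "rd_function (add_edge G e) f"
    using rd_function_mono[of G f "add_edge G e"] by (auto simp: optimal_def add_edge_def)
  then show ?thesis using f gamma_R_le[of "add_edge G e" f] by (simp add: optimal_def)
qed

text \<open>The vertex \<open>v\<close> comes back with label 1, so it neither needs nor provides domination, and the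
  edges at \<open>v\<close> may be chosen freely in \<open>H\<close>.\<close>

lemma rd_function_restore_vert:
  assumes "rd_function (del_vert G v) f" "verts H = verts G"
    and "\<And>e. e \<in> edges G \<Longrightarrow> v \<notin> e \<Longrightarrow> e \<in> edges H"
  shows "rd_function H (f(v := 1))"
  unfolding rd_function_def
proof (intro conjI ballI impI)
  show "(f(v := 1)) ` verts H \<subseteq> {0, 1, 2}"
    using assms(1,2) by (auto simp: rd_function_def del_vert_def)
next
  fix w assume w: "w \<in> verts H" "(f(v := 1)) w = 0"
  then have "w \<noteq> v" "f w = 0" by (auto split: if_splits)
  then obtain u where u: "u \<in> verts G" "u \<noteq> v" "{u, w} \<in> edges G" "f u = 2"
    using rd_function_two[OF assms(1), of w] w(1) assms(2) by (auto simp: del_vert_def)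
  then have "{u, w} \<in> edges H" using assms(3)[of "{u, w}"] \<open>w \<noteq> v\<close> by simp
  then show "\<exists>u\<in>verts H. {u, w} \<in> edges H \<and> (f(v := 1)) u = 2"
    using u assms(2) by auto
qed

lemma gamma_R_le_del_vert:
  assumes "simple_graph G" "v \<in> verts G" "verts H = verts G"
    and "\<And>e. e \<in> edges G \<Longrightarrow> v \<notin> e \<Longrightarrow> e \<in> edges H"
  shows "gamma_R H \<le> gamma_R (del_vert G v) + 1"
proof -
  have fin: "finite (verts G)" using assms(1) by (simp add: simple_graph_def)
  obtain f where f: "optimal (del_vert G v) f" using ex_optimal by blast
  then have "rd_function H (f(v := 1))"
    using rd_function_restore_vert[OF _ assms(3,4)] by (simp add: optimal_def)
  then have "gamma_R H \<le> weight H (f(v := 1))" by (rule gamma_R_le)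
  also have "\<dots> = weight G (f(v := 1))" using assms(3) by (simp add: weight_def)
  also have "\<dots> = gamma_R (del_vert G v) + 1"
    using f weight_upd[OF fin assms(2), of f 1] weight_del_vert[OF fin assms(2), of f]
    by (simp add: optimal_def)
  finally show ?thesis .
qed

text \<open>Since \<open>f\<close> is too cheap for \<open>G\<close>, some vertex \<open>b\<close> with label 0 is dominated only through the new
  edge. Then the other end has label 2, and nothing else depends on the new edge or on \<open>b\<close>.\<close>

lemma add_edge_lowering:
  assumes G: "simple_graph G" and uv: "u \<in> verts G" "v \<in> verts G" "u \<noteq> v"
    and f: "rd_function (add_edge G {u, v}) f" and w: "weight G f < gamma_R G"
  obtains a b where "a = u \<and> b = v \<or> a = v \<and> b = u" "f a = 2" "f b = 0"
    "rd_function (del_vert G b) f"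
proof -
  have "\<not> rd_function G f" using w gamma_R_le[of G f] by auto
  then obtain z where z: "z \<in> verts G" "f z = 0" "\<And>c. c \<in> verts G \<Longrightarrow> {c, z} \<in> edges G \<Longrightarrow> f c \<noteq> 2"
    using f unfolding rd_function_def add_edge_def by auto
  then obtain c where c: "c \<in> verts G" "{c, z} \<in> insert {u, v} (edges G)" "f c = 2"
    using f unfolding rd_function_def add_edge_def by auto
  then have cz: "{c, z} = {u, v}" using z by auto
  have "rd_function (del_vert G z) f"
    unfolding rd_function_def
  proof (intro conjI ballI impI)
    show "f ` verts (del_vert G z) \<subseteq> {0, 1, 2}"
      using f by (auto simp: rd_function_def add_edge_def del_vert_def)
  next
    fix w assume w: "w \<in> verts (del_vert G z)" "f w = 0"
    then obtain d where d: "d \<in> verts G" "{d, w} \<in> insert {u, v} (edges G)" "f d = 2"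
      using f unfolding rd_function_def add_edge_def del_vert_def by auto
    have "d \<noteq> z" "w \<noteq> z" using d z w by (auto simp: del_vert_def)
    then have "z \<notin> {d, w}" by auto
    then have "{d, w} \<noteq> {u, v}" using cz by blast
    then show "\<exists>u\<in>verts (del_vert G z). {u, w} \<in> edges (del_vert G z) \<and> f u = 2"
      using d \<open>d \<noteq> z\<close> \<open>w \<noteq> z\<close> by (auto simp: del_vert_def)
  qed
  then show ?thesis using that[of c z] cz c z by (auto simp: doubleton_eq_iff)
qed

section \<open>Inclusions and disjointness\<close>

lemma graphsD:
  assumes "G \<in> graphs"
  shows "simple_graph G" "finite (verts G)"
  using assms by (auto simp: graphs_def simple_graph_def)

lemma graphs_has_edge:
  assumes "G \<in> graphs"
  obtains u v where "{u, v} \<in> edges G" "u \<in> verts G" "v \<in> verts G" "u \<noteq> v"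
proof -
  obtain e where "e \<in> edges G" using assms by (auto simp: graphs_def edgeless_def)
  then show ?thesis using simple_graph_edgeE[OF graphsD(1)[OF assms]] that by metis
qed

lemma graphs_has_non_edge:
  assumes "G \<in> graphs"
  obtains u v where "u \<in> verts G" "v \<in> verts G" "u \<noteq> v" "{u, v} \<notin> edges G"
proof -
  have "edges G \<subset> all_edges (verts G)"
    using assms by (auto simp: graphs_def complete_graph_def simple_graph_def)
  then show ?thesis using that by (auto simp: all_edges_def)
qed

text \<open>For \<open>e = uv\<close> the edge is irrelevant when \<open>u\<close> has label 1, which costs at most
  \<open>\<gamma>(G - u) + 1 \<le> \<gamma>(G)\<close>.\<close>

lemma CVR_subset_UER: "R_CVR \<subseteq> R_UER"
proof
  fix G :: "'a sgraph" assume G: "G \<in> R_CVR"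
  then have gr: "G \<in> graphs" by (simp add: R_CVR_def)
  have "gamma_R (del_edge G e) = gamma_R G" if "e \<in> edges G" for e
  proof (rule antisym)
    obtain u v where e: "e = {u, v}" "u \<in> verts G"
      using simple_graph_edgeE[OF graphsD(1)[OF gr] \<open>e \<in> edges G\<close>] by blast
    have "gamma_R (del_edge G e) \<le> gamma_R (del_vert G u) + 1"
      using e by (intro gamma_R_le_del_vert graphsD(1)[OF gr]) (auto simp: del_edge_def)
    also have "\<dots> \<le> gamma_R G" using G e by (auto simp: R_CVR_def less_eq_Suc_le)
    finally show "gamma_R (del_edge G e) \<le> gamma_R G" .
  qed (rule gamma_R_del_edge_ge)
  then show "G \<in> R_UER" using gr by (simp add: R_UER_def)
qed

text \<open>An added edge that lowers \<open>\<gamma>\<close> exhibits an end whose deletion lowers \<open>\<gamma>\<close> as well.\<close>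

lemma UVR_subset_UEA: "R_UVR \<subseteq> R_UEA"
proof
  fix G :: "'a sgraph" assume G: "G \<in> R_UVR"
  then have gr: "G \<in> graphs" by (simp add: R_UVR_def)
  note fin = graphsD(2)[OF gr]
  have "gamma_R (add_edge G e) = gamma_R G" if "e \<in> edges (compl_graph G)" for e
  proof (rule ccontr)
    assume "gamma_R (add_edge G e) \<noteq> gamma_R G"
    then have less: "gamma_R (add_edge G e) < gamma_R G" using gamma_R_add_edge_le[of G e] by simp
    obtain u v where e: "e = {u, v}" "u \<in> verts G" "v \<in> verts G" "u \<noteq> v"
      using compl_edgeE[OF \<open>e \<in> edges (compl_graph G)\<close>] by blast
    obtain f where f: "optimal (add_edge G e) f" using ex_optimal by blast
    then have w: "weight G f < gamma_R G" using less by (simp add: optimal_def)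
    have rd: "rd_function (add_edge G {u, v}) f" using f e(1) by (simp add: optimal_def)
    obtain a b where ab: "a = u \<and> b = v \<or> a = v \<and> b = u" "f a = 2" "f b = 0"
        "rd_function (del_vert G b) f"
      by (rule add_edge_lowering[OF graphsD(1)[OF gr] e(2-4) rd w])
    then have b: "b \<in> verts G" using e by auto
    have "gamma_R (del_vert G b) \<le> weight (del_vert G b) f" using ab by (simp add: gamma_R_le)
    also have "\<dots> \<le> weight G f" using weight_del_vert[OF fin b, of f] by simp
    finally show False using w G b by (auto simp: R_UVR_def)
  qed
  then show "G \<in> R_UEA" using gr by (simp add: R_UEA_def)
qed

lemma UER_CER_disjoint: "R_UER \<inter> R_CER = {}"
  by (auto simp: R_UER_def R_CER_def elim: graphs_has_edge)

lemma UVR_CVR_disjoint: "R_UVR \<inter> R_CVR = {}"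
  by (auto simp: R_UVR_def R_CVR_def elim: graphs_has_edge)

lemma UEA_CEA_disjoint: "R_UEA \<inter> R_CEA = {}"
proof -
  have "\<exists>e. e \<in> edges (compl_graph G)" if "G \<in> graphs" for G :: "'a sgraph"
    using that graphs_has_non_edge compl_edgeI by metis
  then show ?thesis by (fastforce simp: R_UEA_def R_CEA_def)
qed

text \<open>Label \<open>u\<close> by 2, both neighbours by 0 and all remaining vertices by 1.\<close>

lemma gamma_R_less_card:
  assumes G: "simple_graph G" and e: "{u, v} \<in> edges G" "{u, w} \<in> edges G" and vw: "v \<noteq> w"
  shows "gamma_R G < card (verts G)"
proof -
  have fin: "finite (verts G)" using G by (simp add: simple_graph_def)
  note D = simple_graph_edgeD[OF G e(1)] simple_graph_edgeD[OF G e(2)]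
  define f where "f = ((\<lambda>_. 1)(u := 2, v := 0, w := 0) :: 'a \<Rightarrow> nat)"
  have "rd_function G f"
    using D e unfolding rd_function_def f_def by auto
  moreover have "weight G f < card (verts G)"
    using weight_upd[OF fin \<open>u \<in> verts G\<close>, of "\<lambda>_. 1" 2]
      weight_upd[OF fin \<open>v \<in> verts G\<close>, of "(\<lambda>_. 1)(u := 2)" 0]
      weight_upd[OF fin \<open>w \<in> verts G\<close>, of "(\<lambda>_. 1)(u := 2, v := 0)" 0] D vw
    by (auto simp: f_def weight_def)
  ultimately show ?thesis using gamma_R_le le_less_trans by blast
qed

text \<open>Delete \<open>u\<close> and take an optimal labelling of the rest. If label 2 occurs, joining \<open>u\<close> to a vertex
  with label 2 costs nothing more, so this edge lowers \<open>\<gamma>\<close>. If label 2 does not occur, \<open>\<gamma>(G)\<close>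
  equals the number of vertices, so \<open>G\<close> has maximum degree at most 1; then extending an edge to a path on
  three vertices lowers \<open>\<gamma>\<close>.\<close>

lemma CVR_UEA_disjoint: "R_CVR \<inter> R_UEA = {}"
proof (rule ccontr)
  assume "R_CVR \<inter> R_UEA \<noteq> ({} :: 'a sgraph set)"
  then obtain G :: "'a sgraph" where G: "G \<in> R_CVR" "G \<in> R_UEA" by blast
  then have gr: "G \<in> graphs" by (simp add: R_CVR_def)
  note sg = graphsD(1)[OF gr] and fin = graphsD(2)[OF gr]
  obtain u v where uv: "{u, v} \<in> edges G" "u \<in> verts G" "v \<in> verts G" "u \<noteq> v"
    using graphs_has_edge[OF gr] by blast
  have add: "gamma_R (add_edge G {a, b}) = gamma_R G"
    if "a \<in> verts G" "b \<in> verts G" "a \<noteq> b" "{a, b} \<notin> edges G" for a b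
    using G(2) compl_edgeI[OF that] by (auto simp: R_UEA_def)
  obtain f where f: "optimal (del_vert G u) f" using ex_optimal by blast
  have wf: "weight (del_vert G u) f < gamma_R G"
    using f G(1) uv by (auto simp: optimal_def R_CVR_def)
  show False
  proof (cases "\<exists>a\<in>verts (del_vert G u). f a = 2")
    case True
    then obtain a where a: "a \<in> verts G" "a \<noteq> u" "f a = 2" by (auto simp: del_vert_def)
    have "gamma_R H \<le> weight (del_vert G u) f"
      if H: "verts H = verts G" "edges G \<subseteq> edges H" "{a, u} \<in> edges H" for H
    proof -
      have rd: "rd_function (del_vert G u) f" using f by (simp add: optimal_def)
      have "rd_function H (f(u := 0))"
        unfolding rd_function_def
      proof (intro conjI ballI impI)
        show "(f(u := 0)) ` verts H \<subseteq> {0, 1, 2}"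
          using rd H(1) by (auto simp: rd_function_def del_vert_def)
      next
        fix w assume w: "w \<in> verts H" "(f(u := 0)) w = 0"
        show "\<exists>c\<in>verts H. {c, w} \<in> edges H \<and> (f(u := 0)) c = 2"
        proof (cases "w = u")
          case True
          then show ?thesis using a H by auto
        next
          case False
          then have "w \<in> verts (del_vert G u)" "f w = 0" using w H(1) by (simp_all add: del_vert_def)
          then obtain c where "c \<in> verts (del_vert G u)" "{c, w} \<in> edges (del_vert G u)" "f c = 2"
            using rd_function_two[OF rd] by blast
          then show ?thesis using H by (auto simp: del_vert_def)
        qed
      qed
      then have "gamma_R H \<le> weight H (f(u := 0))" by (rule gamma_R_le)
      also have "\<dots> = weight G (f(u := 0))" using H by (simp add: weight_def)
      also have "\<dots> = weight (del_vert G u) f"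
        using weight_upd[OF fin uv(2), of f 0] weight_del_vert[OF fin uv(2), of f] by simp
      finally show ?thesis .
    qed
    from this[of G] this[of "add_edge G {a, u}"] show False
      using wf add[OF a(1) uv(2) a(2)] by (auto simp: add_edge_def subset_insertI)
  next
    case False
    have "f w = 1" if "w \<in> verts (del_vert G u)" for w
    proof -
      have rd: "rd_function (del_vert G u) f" using f by (simp add: optimal_def)
      have "f w \<noteq> 0" using rd_function_two[OF rd that] False by metis
      moreover have "f w \<noteq> 2" using that False by blast
      moreover have "f w \<in> {0, 1, 2}" using rd that by (auto simp: rd_function_def)
      ultimately show ?thesis by auto
    qed
    then have "weight (del_vert G u) f = card (verts G - {u})"
      by (simp add: weight_def del_vert_def)
    then have card: "card (verts G) \<le> gamma_R G"
      using wf uv fin by simp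
    have nbr: "b = v" if "{u, b} \<in> edges G" for b
      using gamma_R_less_card[OF sg uv(1) that] card by auto
    have "\<exists>z\<in>verts G. z \<noteq> u \<and> z \<noteq> v"
    proof (rule ccontr)
      assume "\<not> (\<exists>z\<in>verts G. z \<noteq> u \<and> z \<noteq> v)"
      then have "w = u \<or> w = v" if "w \<in> verts G" for w using that by blast
      moreover obtain c d where "c \<in> verts G" "d \<in> verts G" "c \<noteq> d" "{c, d} \<notin> edges G"
        using graphs_has_non_edge[OF gr] by blast
      ultimately show False using uv(1) by (metis insert_commute)
    qed
    then obtain z where z: "z \<in> verts G" "z \<noteq> u" "z \<noteq> v" by blast
    then have nz: "{u, z} \<notin> edges G" using nbr[of z] by auto
    have "simple_graph (add_edge G {u, z})"
      using sg uv z by (auto simp: simple_graph_def add_edge_def all_edges_def)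
    then have "gamma_R (add_edge G {u, z}) < card (verts (add_edge G {u, z}))"
      by (rule gamma_R_less_card[of _ u v z]) (use uv z in \<open>auto simp: add_edge_def\<close>)
    then show False using add[OF uv(2) z(1) z(2)[symmetric] nz] card by (simp add: add_edge_def)
  qed
qed

section \<open>Edge-addition-critical graphs have no critical edges\<close>

text \<open>Otherwise the label 1 could be lowered to 0.\<close>

lemma optimal_no_two_next_to_one:
  assumes G: "simple_graph G" and f: "optimal G f" and e: "{a, b} \<in> edges G" and b: "f b = 1"
  shows "f a \<noteq> 2"
proof
  assume a: "f a = 2"
  note D = simple_graph_edgeD[OF G e]
  have fin: "finite (verts G)" using G by (simp add: simple_graph_def)
  have rd: "rd_function G f" using f by (simp add: optimal_def)
  have "rd_function G (f(b := 0))"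
    unfolding rd_function_def
  proof (intro conjI ballI impI)
    show "(f(b := 0)) ` verts G \<subseteq> {0, 1, 2}" using rd by (auto simp: rd_function_def)
  next
    fix w assume w: "w \<in> verts G" "(f(b := 0)) w = 0"
    show "\<exists>c\<in>verts G. {c, w} \<in> edges G \<and> (f(b := 0)) c = 2"
    proof (cases "w = b")
      case True
      then show ?thesis using a e D by auto
    next
      case False
      then obtain c where c: "c \<in> verts G" "{c, w} \<in> edges G" "f c = 2"
        using w rd_function_two[OF rd w(1)] by auto
      then have "(f(b := 0)) c = 2" using b by auto
      then show ?thesis using c by blast
    qed
  qed
  then have "gamma_R G \<le> weight G (f(b := 0))" by (rule gamma_R_le)
  then show False using weight_upd[OF fin D(2), of f 0] f b by (simp add: optimal_def)
qed

text \<open>The situation to be refuted. It is symmetric in \<open>x\<close> and \<open>y\<close>; a fact about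
  \<open>x\<close> with the two ends exchanged goes under a name ending in \<open>swapped\<close>.\<close>

locale critical_edge_in_CEA =
  fixes G :: "'a sgraph" and x y :: 'a
  assumes CEA: "G \<in> R_CEA"
    and edge: "{x, y} \<in> edges G"
    and critical: "gamma_R G < gamma_R (del_edge G {x, y})"
begin

lemma gr: "G \<in> graphs" using CEA by (simp add: R_CEA_def)
lemmas sg = graphsD(1)[OF gr] and fin = graphsD(2)[OF gr]
lemmas xy = simple_graph_edgeD[OF sg edge]

lemma swap: "critical_edge_in_CEA G y x"
  using CEA edge critical by unfold_locales (simp_all add: insert_commute)

abbreviation adj (infix "\<sim>" 50) where "a \<sim> b \<equiv> {a, b} \<in> edges G"

lemma adjD: "a \<sim> b \<Longrightarrow> a \<in> verts G" "a \<sim> b \<Longrightarrow> b \<in> verts G" "a \<sim> b \<Longrightarrow> a \<noteq> b" "a \<sim> b \<Longrightarrow> b \<sim> a"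
  using simple_graph_edgeD[OF sg] by (auto simp: insert_commute)

text \<open>An optimal labelling that did not depend on \<open>xy\<close> would be valid after deletion of this edge.\<close>

lemma optimal_labels:
  assumes "optimal G f"
  shows "f x = 2 \<and> f y = 0 \<and> (\<forall>w. w \<sim> y \<longrightarrow> w \<noteq> x \<longrightarrow> f w \<noteq> 2) \<or>
         f y = 2 \<and> f x = 0 \<and> (\<forall>w. w \<sim> x \<longrightarrow> w \<noteq> y \<longrightarrow> f w \<noteq> 2)"
proof -
  have "\<not> rd_function (del_edge G {x, y}) f"
    using assms critical gamma_R_le[of "del_edge G {x, y}" f] by (auto simp: optimal_def)
  then obtain z where z: "z \<in> verts G" "f z = 0"
      "\<And>w. w \<in> verts G \<Longrightarrow> w \<sim> z \<Longrightarrow> {w, z} \<noteq> {x, y} \<Longrightarrow> f w \<noteq> 2"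
    using assms unfolding optimal_def rd_function_def del_edge_def by auto
  then obtain c where c: "c \<sim> z" "f c = 2" "c \<in> verts G"
    using assms unfolding optimal_def rd_function_def by blast
  then have "{c, z} = {x, y}" using z by blast
  then consider "c = x" "z = y" | "c = y" "z = x" by (auto simp: doubleton_eq_iff)
  then show ?thesis
    by cases (use z c xy in \<open>auto simp: doubleton_eq_iff dest: adjD\<close>)
qed

text \<open>Take a labelling that becomes cheaper thanks to the new edge \<open>uv\<close>, and raise the end with label 0
  to 1.\<close>

lemma optimal_of_non_adjacent:
  assumes "u \<in> verts G" "v \<in> verts G" "u \<noteq> v" "\<not> u \<sim> v"
  obtains f where "optimal G f" "f u = 2 \<and> f v = 1 \<or> f u = 1 \<and> f v = 2"
proof -
  have less: "gamma_R (add_edge G {u, v}) < gamma_R G"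
    using CEA compl_edgeI[OF assms] by (auto simp: R_CEA_def)
  obtain f where f: "optimal (add_edge G {u, v}) f" using ex_optimal by blast
  then have w: "weight G f < gamma_R G" using less by (simp add: optimal_def)
  obtain a b where ab: "a = u \<and> b = v \<or> a = v \<and> b = u" "f a = 2" "f b = 0"
      "rd_function (del_vert G b) f"
    by (rule add_edge_lowering[OF sg assms(1-3) _ w]) (use f in \<open>auto simp: optimal_def\<close>)
  have "rd_function G (f(b := 1))"
    by (rule rd_function_restore_vert[OF ab(4)]) auto
  moreover have "weight G (f(b := 1)) \<le> gamma_R G"
    using weight_upd[OF fin, of b f 1] ab assms w by auto
  ultimately have "optimal G (f(b := 1))" by (rule optimalI)
  then show ?thesis using that[of "f(b := 1)"] ab assms by auto
qed

text \<open>If \<open>a\<close> and \<open>b\<close> were not adjacent, some optimal labelling would put 2 on one of them and 1 on the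
  other. The label 1 forbids 2 on the common neighbour \<open>x\<close>, and the label 2 forbids that \<open>x\<close> is
  dominated by \<open>y\<close> alone.\<close>

lemma neighbours_clique:
  assumes "x \<sim> a" "x \<sim> b" "a \<noteq> y" "b \<noteq> y" "a \<noteq> b"
  shows "a \<sim> b"
proof (rule ccontr)
  assume "\<not> a \<sim> b"
  then obtain f where f: "optimal G f" "f a = 2 \<and> f b = 1 \<or> f a = 1 \<and> f b = 2"
    using optimal_of_non_adjacent[of a b] adjD assms by blast
  then have "f x \<noteq> 2"
    using optimal_no_two_next_to_one[OF sg f(1) assms(1)] optimal_no_two_next_to_one[OF sg f(1) assms(2)]
    by auto
  then have "f a \<noteq> 2" "f b \<noteq> 2"
    using optimal_labels[OF f(1)] adjD(4)[OF assms(1)] adjD(4)[OF assms(2)] assms(3,4) by auto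
  then show False using f(2) by auto
qed

text \<open>If \<open>a\<close> has label 2, it dominates all that \<open>x\<close> dominates except \<open>y\<close>, by \<open>neighbours_clique\<close>. Then
  changing the labels of \<open>x\<close> and \<open>y\<close> from 2 and 0 to 0 and 1 saves one.\<close>

lemma optimal_no_two_at_neighbour:
  assumes f: "optimal G f" and a: "x \<sim> a" "a \<noteq> y"
  shows "f a \<noteq> 2"
proof
  assume fa: "f a = 2"
  then have lab: "f x = 2" "f y = 0" using optimal_labels[OF f] a(2) adjD(4)[OF a(1)] by auto
  let ?h = "f(x := 0, y := 1)"
  have "rd_function G ?h"
    unfolding rd_function_def
  proof (intro conjI ballI impI)
    show "?h ` verts G \<subseteq> {0, 1, 2}" using f by (auto simp: optimal_def rd_function_def)
  next
    fix w assume w: "w \<in> verts G" "?h w = 0"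
    show "\<exists>c\<in>verts G. c \<sim> w \<and> ?h c = 2"
    proof (cases "w = x \<or> x \<sim> w")
      case True
      have "w \<noteq> y" "w \<noteq> a" using w lab fa a adjD(3)[OF a(1)] by (auto split: if_splits)
      then have "a \<sim> w"
        using True adjD(4)[OF a(1)] neighbours_clique[OF a(1) _ a(2)] by blast
      moreover have "?h a = 2" using fa a(2) adjD(3)[OF a(1)] by auto
      ultimately show ?thesis using adjD(1) by blast
    next
      case False
      then have "f w = 0" using w by (auto split: if_splits)
      then obtain c where c: "c \<in> verts G" "c \<sim> w" "f c = 2"
        using f w by (auto simp: optimal_def rd_function_def)
      then have "?h c = 2" using False lab by auto
      then show ?thesis using c by blast
    qed
  qed
  then have "gamma_R G \<le> weight G ?h" by (rule gamma_R_le)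
  then show False
    using weight_upd[OF fin xy(1), of f 0] weight_upd[OF fin xy(2), of "f(x := 0)" 1] lab f xy
    by (simp add: optimal_def)
qed

lemmas neighbours_clique_swapped = critical_edge_in_CEA.neighbours_clique[OF swap]
lemmas optimal_no_two_at_neighbour_swapped = critical_edge_in_CEA.optimal_no_two_at_neighbour[OF swap]

text \<open>A non-edge would force label 2 onto \<open>p\<close> or \<open>q\<close> in some optimal labelling.\<close>

lemma cross_adjacent:
  assumes "x \<sim> p" "p \<noteq> y" "y \<sim> q" "q \<noteq> x" "p \<noteq> q"
  shows "p \<sim> q"
proof (rule ccontr)
  assume "\<not> p \<sim> q"
  then obtain f where f: "optimal G f" "f p = 2 \<or> f q = 2"
    using optimal_of_non_adjacent[of p q] adjD(2)[OF assms(1)] adjD(2)[OF assms(3)] assms(5) by blast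
  then show False
    using optimal_no_two_at_neighbour[OF f(1) assms(1,2)]
      optimal_no_two_at_neighbour_swapped[OF f(1) assms(3,4)] by blast
qed

text \<open>A common neighbour \<open>t\<close> is adjacent to everything in the neighbourhood of \<open>x\<close>, including \<open>y\<close>. So a
  label 2 on \<open>x\<close> could be moved to \<open>t\<close>, where it is excluded.\<close>

lemma common_neighbour_label:
  assumes t: "x \<sim> t" "y \<sim> t" and f: "optimal G f"
  shows "f x \<noteq> 2"
proof
  assume fx: "f x = 2"
  have ty: "t \<noteq> y" "t \<noteq> x" using adjD(3)[OF t(1)] adjD(3)[OF t(2)] by auto
  let ?h = "f(x := 0, t := 2)"
  have "rd_function G ?h"
    unfolding rd_function_def
  proof (intro conjI ballI impI)
    show "?h ` verts G \<subseteq> {0, 1, 2}" using f by (auto simp: optimal_def rd_function_def)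
  next
    fix w assume w: "w \<in> verts G" "?h w = 0"
    then have wt: "w \<noteq> t" by auto
    show "\<exists>c\<in>verts G. c \<sim> w \<and> ?h c = 2"
    proof (cases "w = x \<or> x \<sim> w")
      case True
      then have "t \<sim> w"
        using adjD(4)[OF t(1)] adjD(4)[OF t(2)] neighbours_clique[OF t(1) _ ty(1)] wt by blast
      moreover have "?h t = 2" by simp
      ultimately show ?thesis using adjD(1) by blast
    next
      case False
      then have "f w = 0" using w wt by auto
      then obtain c where c: "c \<in> verts G" "c \<sim> w" "f c = 2"
        using f w by (auto simp: optimal_def rd_function_def)
      then have "?h c = 2" using False by auto
      then show ?thesis using c by blast
    qed
  qed
  moreover have "weight G ?h \<le> gamma_R G"
    using weight_upd[OF fin xy(1), of f 0] weight_upd[OF fin adjD(2)[OF t(1)], of "f(x := 0)" 2]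
      fx f ty by (simp add: optimal_def)
  ultimately have "optimal G ?h" by (rule optimalI)
  then show False using optimal_no_two_at_neighbour[OF _ t(1) ty(1)] by (metis fun_upd_same)
qed

lemmas common_neighbour_label_swapped = critical_edge_in_CEA.common_neighbour_label[OF swap]

lemma no_common_neighbour: "x \<sim> t \<Longrightarrow> \<not> y \<sim> t"
  using ex_optimal[of G] optimal_labels common_neighbour_label common_neighbour_label_swapped by metis

text \<open>Let \<open>t \<noteq> y\<close> be a neighbour of \<open>x\<close>. It is not adjacent to \<open>y\<close>, so some optimal labelling has 2 on
  \<open>y\<close>, 1 on \<open>t\<close> and 0 on \<open>x\<close>. If \<open>y\<close> has a second neighbour \<open>q\<close>, then \<open>q\<close> can do the work of \<open>y\<close>
  and also dominate \<open>t\<close>; what is saved there pays for a label 1 on \<open>x\<close>, and \<open>q\<close> ends with the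
  excluded label 2. If \<open>y\<close> has no second neighbour, moving its label 2 to \<open>x\<close> dominates \<open>t\<close> in
  addition and saves one.\<close>

lemma no_other_neighbour:
  assumes t: "x \<sim> t"
  shows "t = y"
proof (rule ccontr)
  assume ty: "t \<noteq> y"
  have tx: "t \<noteq> x" and tV: "t \<in> verts G" using adjD(2,3)[OF t] by auto
  have nyt: "\<not> y \<sim> t" by (rule no_common_neighbour[OF t])
  then obtain f where f: "optimal G f" "f y = 2 \<and> f t = 1 \<or> f y = 1 \<and> f t = 2"
    using optimal_of_non_adjacent[of y t] xy tV ty by blast
  then have lab: "f y = 2" "f t = 1" "f x = 0"
    using optimal_no_two_at_neighbour[OF f(1) t ty] optimal_labels[OF f(1)] by auto
  have rd: "f ` verts G \<subseteq> {0, 1, 2}" "\<And>w. w \<in> verts G \<Longrightarrow> f w = 0 \<Longrightarrow> \<exists>c\<in>verts G. c \<sim> w \<and> f c = 2"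
    using f(1) by (auto simp: optimal_def rd_function_def)
  show False
  proof (cases "\<exists>q. y \<sim> q \<and> q \<noteq> x")
    case True
    then obtain q where q: "y \<sim> q" "q \<noteq> x" by blast
    have qt: "q \<noteq> t" and qy: "q \<noteq> y" and qV: "q \<in> verts G"
      using q nyt adjD(2,3)[OF q(1)] by auto
    have q_t: "q \<sim> t" by (rule adjD(4)[OF cross_adjacent[OF t ty q qt[symmetric]]])
    let ?h = "f(y := 0, x := 1, q := 2, t := 0)"
    have "rd_function G ?h"
      unfolding rd_function_def
    proof (intro conjI ballI impI)
      show "?h ` verts G \<subseteq> {0, 1, 2}" using rd(1) by auto
    next
      fix w assume w: "w \<in> verts G" "?h w = 0"
      then have wq: "w \<noteq> q" "w \<noteq> x" using qt tx by (auto split: if_splits)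
      show "\<exists>c\<in>verts G. c \<sim> w \<and> ?h c = 2"
      proof (cases "w = t \<or> w = y \<or> y \<sim> w")
        case True
        then have "q \<sim> w"
          using q_t adjD(4)[OF q(1)] neighbours_clique_swapped[OF q(1) _ q(2) wq(2)] wq(1) by blast
        moreover have "?h q = 2" using qt by auto
        ultimately show ?thesis using qV by blast
      next
        case False
        then have "f w = 0" using w wq by auto
        then obtain c where c: "c \<in> verts G" "c \<sim> w" "f c = 2" using rd(2) w by blast
        then have "?h c = 2" using False lab by auto
        then show ?thesis using c by blast
      qed
    qed
    moreover have "weight G ?h \<le> gamma_R G"
      using weight_upd[OF fin xy(2), of f 0] weight_upd[OF fin xy(1), of "f(y := 0)" 1]
        weight_upd[OF fin qV, of "f(y := 0, x := 1)" 2]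
        weight_upd[OF fin tV, of "f(y := 0, x := 1, q := 2)" 0]
        lab f(1) ty tx xy q(2) qt qy by (simp add: optimal_def)
    ultimately have "optimal G ?h" by (rule optimalI)
    then have "?h q \<noteq> 2" using optimal_no_two_at_neighbour_swapped[OF _ q] by blast
    then show False using qt by simp
  next
    case False
    let ?h = "f(y := 0, x := 2, t := 0)"
    have "rd_function G ?h"
      unfolding rd_function_def
    proof (intro conjI ballI impI)
      show "?h ` verts G \<subseteq> {0, 1, 2}" using rd(1) by auto
    next
      fix w assume w: "w \<in> verts G" "?h w = 0"
      then have wx: "w \<noteq> x" using tx by (auto split: if_splits)
      have hx: "?h x = 2" using tx by auto
      show "\<exists>c\<in>verts G. c \<sim> w \<and> ?h c = 2"
      proof (cases "w = t \<or> w = y")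
        case True
        then show ?thesis using hx t edge xy(1) by blast
      next
        case nt: False
        then have "f w = 0" using w wx by auto
        then obtain c where c: "c \<in> verts G" "c \<sim> w" "f c = 2" using rd(2) w by blast
        then have "?h c = 2" using False wx lab by auto
        then show ?thesis using c by blast
      qed
    qed
    then have "gamma_R G \<le> weight G ?h" by (rule gamma_R_le)
    then show False
      using weight_upd[OF fin xy(2), of f 0] weight_upd[OF fin xy(1), of "f(y := 0)" 2]
        weight_upd[OF fin tV, of "f(y := 0, x := 2)" 0] lab f(1) ty tx xy
      by (simp add: optimal_def)
  qed
qed

lemmas no_other_neighbour_swapped = critical_edge_in_CEA.no_other_neighbour[OF swap]

text \<open>Now \<open>x\<close> and \<open>y\<close> form a component of their own, on which labels 1 and 1 are as good as 2 and 0.\<close>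

lemma contradiction: False
proof -
  obtain f where f: "optimal G f" using ex_optimal by blast
  let ?h = "f(x := 1, y := 1)"
  have lab: "f x = 2 \<and> f y = 0 \<or> f y = 2 \<and> f x = 0" using optimal_labels[OF f] by blast
  have "rd_function G ?h"
    unfolding rd_function_def
  proof (intro conjI ballI impI)
    show "?h ` verts G \<subseteq> {0, 1, 2}" using f by (auto simp: optimal_def rd_function_def)
  next
    fix w assume w: "w \<in> verts G" "?h w = 0"
    then have wxy: "w \<noteq> x" "w \<noteq> y" "f w = 0" by (auto split: if_splits)
    then obtain c where c: "c \<in> verts G" "c \<sim> w" "f c = 2"
      using f w by (auto simp: optimal_def rd_function_def)
    have "c \<noteq> x" using no_other_neighbour[of w] c(2) wxy(2) by auto
    moreover have "c \<noteq> y" using no_other_neighbour_swapped[of w] c(2) wxy(1) by auto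
    ultimately have "?h c = 2" using c(3) by simp
    then show "\<exists>c\<in>verts G. c \<sim> w \<and> ?h c = 2" using c by blast
  qed
  moreover have "weight G ?h \<le> gamma_R G"
    using weight_upd[OF fin xy(1), of f 1] weight_upd[OF fin xy(2), of "f(x := 1)" 1]
      lab f xy(3)[symmetric] by (elim disjE) (simp_all add: optimal_def)
  ultimately have "optimal G ?h" by (rule optimalI)
  from optimal_labels[OF this] show False by auto
qed

end

lemma CEA_subset_UER: "R_CEA \<subseteq> R_UER"
proof
  fix G :: "'a sgraph" assume G: "G \<in> R_CEA"
  then have gr: "G \<in> graphs" by (simp add: R_CEA_def)
  have "gamma_R (del_edge G e) = gamma_R G" if "e \<in> edges G" for e
  proof (rule ccontr)
    assume "gamma_R (del_edge G e) \<noteq> gamma_R G"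
    then have less: "gamma_R G < gamma_R (del_edge G e)" using gamma_R_del_edge_ge[of G e] by simp
    obtain x y where e: "e = {x, y}"
      using simple_graph_edgeE[OF graphsD(1)[OF gr] \<open>e \<in> edges G\<close>] by blast
    then have "critical_edge_in_CEA G x y"
      using G \<open>e \<in> edges G\<close> less by unfold_locales auto
    then show False by (rule critical_edge_in_CEA.contradiction)
  qed
  then show "G \<in> R_UER" using gr by (simp add: R_UER_def)
qed

section \<open>Computing Roman domination numbers\<close>

text \<open>Here \<open>S\<close> is the set of vertices with label 2.\<close>

theorem gamma_R_le_iff:
  assumes "finite (verts G)"
  shows "gamma_R G \<le> k \<longleftrightarrow>
    (\<exists>S \<subseteq> verts G. 2 * card S + card {v \<in> verts G. v \<notin> S \<and> (\<forall>u\<in>S. {u, v} \<notin> edges G)} \<le> k)"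
    (is "_ \<longleftrightarrow> (\<exists>S \<subseteq> _. 2 * card S + card (?U S) \<le> k)")
proof
  assume k: "gamma_R G \<le> k"
  obtain f where f: "optimal G f" using ex_optimal by blast
  define S where "S = {v \<in> verts G. f v = 2}"
  have fin: "finite S" "finite (?U S)" "S \<inter> ?U S = {}" using assms by (auto simp: S_def)
  have "2 * card S + card (?U S) = (\<Sum>v\<in>S. 2) + (\<Sum>v\<in>?U S. 1)" by simp
  also have "\<dots> \<le> sum f S + sum f (?U S)"
  proof (rule add_mono; rule sum_mono)
    fix v assume v: "v \<in> ?U S"
    have rd: "rd_function G f" using f by (simp add: optimal_def)
    have "f v \<noteq> 0"
    proof
      assume "f v = 0"
      then obtain u where "u \<in> verts G" "{u, v} \<in> edges G" "f u = 2"
        using rd_function_two[OF rd, of v] v by blast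
      then show False using v by (simp add: S_def)
    qed
    then show "1 \<le> f v" by simp
  qed (simp add: S_def)
  also have "\<dots> = sum f (S \<union> ?U S)" using fin by (simp add: sum.union_disjoint)
  also have "\<dots> \<le> weight G f"
    unfolding weight_def by (rule sum_mono2) (use assms in \<open>auto simp: S_def\<close>)
  finally have "2 * card S + card (?U S) \<le> k" using f k by (simp add: optimal_def)
  moreover have "S \<subseteq> verts G" by (auto simp: S_def)
  ultimately show "\<exists>S\<subseteq>verts G. 2 * card S + card (?U S) \<le> k" by blast
next
  assume "\<exists>S\<subseteq>verts G. 2 * card S + card (?U S) \<le> k"
  then obtain S where S: "S \<subseteq> verts G" "2 * card S + card (?U S) \<le> k" by blast
  define f where "f v = (if v \<in> S then 2 else if v \<in> ?U S then 1 else 0 :: nat)" for v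
  have "rd_function G f"
    unfolding rd_function_def
  proof (intro conjI ballI impI)
    fix v assume "v \<in> verts G" "f v = 0"
    then obtain u where u: "u \<in> S" "{u, v} \<in> edges G" by (auto simp: f_def split: if_splits)
    then have "u \<in> verts G" "f u = 2" using S(1) by (auto simp: f_def)
    then show "\<exists>u\<in>verts G. {u, v} \<in> edges G \<and> f u = 2" using u by blast
  qed (auto simp: f_def)
  moreover have "weight G f = 2 * card S + card (?U S)"
  proof -
    have fin: "finite S" "finite (?U S)" "S \<inter> ?U S = {}" using assms finite_subset[OF S(1) assms] by auto
    have "weight G f = sum f (S \<union> ?U S)"
      unfolding weight_def
      by (rule sum.mono_neutral_right) (use S assms in \<open>auto simp: f_def\<close>)
    also have "\<dots> = sum f S + sum f (?U S)" by (rule sum.union_disjoint[OF fin])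
    also have "sum f S = (\<Sum>v\<in>S. 2)" by (rule sum.cong) (simp_all add: f_def)
    also have "sum f (?U S) = (\<Sum>v\<in>?U S. 1)" by (rule sum.cong) (simp_all add: f_def)
    finally show ?thesis by simp
  qed
  ultimately show "gamma_R G \<le> k" using gamma_R_le S(2) by fastforce
qed

definition lgraph :: "'a list \<Rightarrow> ('a \<times> 'a) list \<Rightarrow> 'a sgraph" where
  "lgraph vs es = \<lparr>verts = set vs, edges = (\<lambda>(a, b). {a, b}) ` set es\<rparr>"

definition joined :: "('a \<times> 'a) list \<Rightarrow> 'a \<Rightarrow> 'a \<Rightarrow> bool" where
  "joined es a b \<longleftrightarrow> list_ex (\<lambda>(c, d). c = a \<and> d = b \<or> c = b \<and> d = a) es"

lemma verts_lgraph [simp]: "verts (lgraph vs es) = set vs"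
  by (simp add: lgraph_def)

lemma edge_lgraph_iff: "{a, b} \<in> edges (lgraph vs es) \<longleftrightarrow> joined es a b"
  by (force simp: lgraph_def joined_def list_ex_iff doubleton_eq_iff)

text \<open>Only sets of at most \<open>k div 2\<close> vertices can carry label 2 in a labelling of weight at most \<open>k\<close>. The
  cutoff keeps the search small: refuting weight 3 only needs single vertices.\<close>

fun sublists_upto :: "nat \<Rightarrow> 'a list \<Rightarrow> 'a list list" where
  "sublists_upto 0 xs = [[]]"
| "sublists_upto (Suc m) [] = [[]]"
| "sublists_upto (Suc m) (x # xs) = map ((#) x) (sublists_upto m xs) @ sublists_upto (Suc m) xs"

lemma sublists_upto_sound:
  "S \<in> set (sublists_upto m xs) \<Longrightarrow> distinct xs \<Longrightarrow> distinct S \<and> set S \<subseteq> set xs"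
  by (induction m xs arbitrary: S rule: sublists_upto.induct) (auto, (blast dest: subsetD)+)

lemma sublists_upto_complete:
  "A \<subseteq> set xs \<Longrightarrow> card A \<le> m \<Longrightarrow> \<exists>S \<in> set (sublists_upto m xs). set S = A"
proof (induction m xs arbitrary: A rule: sublists_upto.induct)
  case (3 m x xs)
  show ?case
  proof (cases "x \<in> A")
    case True
    have fin: "finite A" using 3(3) by (rule finite_subset) simp
    then have "A - {x} \<subseteq> set xs" "card (A - {x}) \<le> m" using 3 True by auto
    then obtain S where S: "S \<in> set (sublists_upto m xs)" "set S = A - {x}" using 3(1) by metis
    then show ?thesis using True by (intro bexI[of _ "x # S"]) auto
  next
    case False
    then have "A \<subseteq> set xs" using 3(3) by auto
    then show ?thesis using 3(2)[of A] 3(4) by auto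
  qed
qed (auto dest: finite_subset)

definition cost :: "'a list \<Rightarrow> ('a \<times> 'a) list \<Rightarrow> 'a list \<Rightarrow> nat" where
  "cost vs es S = 2 * length S +
     length (filter (\<lambda>v. \<not> List.member S v \<and> \<not> list_ex (\<lambda>u. joined es u v) S) vs)"

definition rd_within :: "'a list \<Rightarrow> ('a \<times> 'a) list \<Rightarrow> nat \<Rightarrow> bool" where
  "rd_within vs es k \<longleftrightarrow> list_ex (\<lambda>S. cost vs es S \<le> k) (sublists_upto (k div 2) vs)"

text \<open>Since \<^const>\<open>rd_within\<close> is monotone in \<open>k\<close>, the values below \<open>\<gamma>\<close> form an initial segment. The range
  of the search suffices because labelling all vertices by 1 shows that \<open>\<gamma>\<close> is at most their number.\<close>

definition gamma_list :: "'a list \<Rightarrow> ('a \<times> 'a) list \<Rightarrow> nat" where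
  "gamma_list vs es = length (takeWhile (\<lambda>k. \<not> rd_within vs es k) [0..<length vs])"

lemma cost_eq:
  assumes "distinct vs" "distinct S"
  shows "cost vs es S = 2 * card (set S) +
    card {v \<in> verts (lgraph vs es). v \<notin> set S \<and> (\<forall>u\<in>set S. {u, v} \<notin> edges (lgraph vs es))}"
proof -
  have "length (filter (\<lambda>v. \<not> List.member S v \<and> \<not> list_ex (\<lambda>u. joined es u v) S) vs) =
      card (set (filter (\<lambda>v. \<not> List.member S v \<and> \<not> list_ex (\<lambda>u. joined es u v) S) vs))"
    using assms by (simp only: distinct_card distinct_filter)
  also have "set (filter (\<lambda>v. \<not> List.member S v \<and> \<not> list_ex (\<lambda>u. joined es u v) S) vs) =
      {v \<in> set vs. v \<notin> set S \<and> (\<forall>u\<in>set S. \<not> joined es u v)}"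
    by (auto simp: list_ex_iff)
  finally show ?thesis
    using assms by (simp add: cost_def edge_lgraph_iff distinct_card)
qed

lemma gamma_R_lgraph_le_iff:
  assumes "distinct vs"
  shows "gamma_R (lgraph vs es) \<le> k \<longleftrightarrow> rd_within vs es k"
proof
  assume "gamma_R (lgraph vs es) \<le> k"
  then obtain A where A: "A \<subseteq> set vs" "2 * card A + card {v \<in> verts (lgraph vs es). v \<notin> A \<and>
      (\<forall>u\<in>A. {u, v} \<notin> edges (lgraph vs es))} \<le> k"
    unfolding gamma_R_le_iff[of "lgraph vs es", simplified] by auto
  then have "card A \<le> k div 2" by auto
  then obtain S where S: "S \<in> set (sublists_upto (k div 2) vs)" "set S = A"
    using sublists_upto_complete[OF A(1)] by blast
  then have "cost vs es S \<le> k"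
    using A(2) sublists_upto_sound[OF S(1) assms] cost_eq[OF assms, of S es] by simp
  then show "rd_within vs es k" using S by (auto simp: rd_within_def list_ex_iff)
next
  assume "rd_within vs es k"
  then obtain S where S: "S \<in> set (sublists_upto (k div 2) vs)" "cost vs es S \<le> k"
    by (auto simp: rd_within_def list_ex_iff)
  then show "gamma_R (lgraph vs es) \<le> k"
    using sublists_upto_sound[OF S(1) assms] cost_eq[OF assms, of S es]
    by (subst gamma_R_le_iff) (auto intro!: exI[of _ "set S"])
qed

lemma gamma_R_lgraph:
  assumes "distinct vs"
  shows "gamma_R (lgraph vs es) = gamma_list vs es"
proof -
  let ?P = "\<lambda>k. \<not> rd_within vs es k"
  have P: "?P k \<longleftrightarrow> k < gamma_R (lgraph vs es)" for k
    using gamma_R_lgraph_le_iff[OF assms, of es k] by auto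
  have "gamma_R (lgraph vs es) \<le> weight (lgraph vs es) (\<lambda>_. 1)"
    by (rule gamma_R_le) (auto simp: rd_function_def)
  then have le: "gamma_R (lgraph vs es) \<le> length vs"
    using card_length[of vs] by (simp add: weight_def)
  have "takeWhile ?P [0..<length vs] = [0..<gamma_R (lgraph vs es)]"
  proof -
    have "[0..<length vs] = [0..<gamma_R (lgraph vs es)] @ [gamma_R (lgraph vs es)..<length vs]"
      using le by (metis upt_add_eq_append le0 le_add_diff_inverse)
    moreover have "takeWhile ?P [gamma_R (lgraph vs es)..<length vs] = []"
      by (cases "gamma_R (lgraph vs es) < length vs") (simp_all add: P upt_conv_Cons)
    moreover have "takeWhile ?P ([0..<gamma_R (lgraph vs es)] @ zs) =
        [0..<gamma_R (lgraph vs es)] @ takeWhile ?P zs" for zs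
      by (rule takeWhile_append2) (simp add: P)
    ultimately show ?thesis by simp
  qed
  then show ?thesis by (simp add: gamma_list_def)
qed

text \<open>The order on the vertices serves to list each non-edge only once.\<close>

definition non_edges :: "'a::linorder list \<Rightarrow> ('a \<times> 'a) list \<Rightarrow> ('a \<times> 'a) list" where
  "non_edges vs es = filter (\<lambda>(a, b). a < b \<and> \<not> joined es a b) (List.product vs vs)"

definition del_vert_gammas :: "'a list \<Rightarrow> ('a \<times> 'a) list \<Rightarrow> nat list" where
  "del_vert_gammas vs es = map (\<lambda>v. gamma_list (filter (\<lambda>u. u \<noteq> v) vs)
     (filter (\<lambda>(a, b). a \<noteq> v \<and> b \<noteq> v) es)) vs"

definition del_edge_gammas :: "'a list \<Rightarrow> ('a \<times> 'a) list \<Rightarrow> nat list" where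
  "del_edge_gammas vs es = map (\<lambda>(a, b). gamma_list vs
     (filter (\<lambda>(c, d). \<not> (c = a \<and> d = b \<or> c = b \<and> d = a)) es)) es"

definition add_edge_gammas :: "'a::linorder list \<Rightarrow> ('a \<times> 'a) list \<Rightarrow> nat list" where
  "add_edge_gammas vs es = map (\<lambda>e. gamma_list vs (e # es)) (non_edges vs es)"

text \<open>The list form of membership in \<^const>\<open>graphs\<close>.\<close>

definition proper :: "'a::linorder list \<Rightarrow> ('a \<times> 'a) list \<Rightarrow> bool" where
  "proper vs es \<longleftrightarrow> distinct vs \<and>
     list_all (\<lambda>(a, b). List.member vs a \<and> List.member vs b \<and> a \<noteq> b) es \<and>
     es \<noteq> [] \<and> non_edges vs es \<noteq> []"

lemma image_set_filter: "f ` set (filter (\<lambda>p. P (f p)) xs) = {e \<in> f ` set xs. P e}"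
  by auto

lemma del_vert_lgraph:
  "del_vert (lgraph vs es) v =
     lgraph (filter (\<lambda>u. u \<noteq> v) vs) (filter (\<lambda>(a, b). a \<noteq> v \<and> b \<noteq> v) es)"
proof -
  have "(\<lambda>(a, b). a \<noteq> v \<and> b \<noteq> v) = (\<lambda>p. v \<notin> (case p of (a, b) \<Rightarrow> {a, b}))"
    by (rule ext) (simp split: prod.split, metis)
  moreover have "set vs - {v} = set (filter (\<lambda>u. u \<noteq> v) vs)" by auto
  ultimately show ?thesis
    by (simp only: del_vert_def lgraph_def image_set_filter[of _ "\<lambda>e. v \<notin> e"] sgraph.simps)
qed

lemma del_edge_lgraph:
  "del_edge (lgraph vs es) {a, b} =
     lgraph vs (filter (\<lambda>(c, d). \<not> (c = a \<and> d = b \<or> c = b \<and> d = a)) es)"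
proof -
  have "(\<lambda>(c, d). \<not> (c = a \<and> d = b \<or> c = b \<and> d = a)) =
      (\<lambda>p. (case p of (c, d) \<Rightarrow> {c, d}) \<noteq> {a, b})"
    by (rule ext) (simp add: doubleton_eq_iff split: prod.split)
  moreover have "E - {{a, b}} = {e \<in> E. e \<noteq> {a, b}}" for E by blast
  ultimately show ?thesis
    by (simp only: del_edge_def lgraph_def image_set_filter[of _ "\<lambda>e. e \<noteq> {a, b}"] sgraph.simps)
qed

lemma add_edge_lgraph: "add_edge (lgraph vs es) {a, b} = lgraph vs ((a, b) # es)"
  by (simp add: add_edge_def lgraph_def)

lemma compl_edges_lgraph:
  "edges (compl_graph (lgraph vs es)) = (\<lambda>(a, b). {a, b}) ` set (non_edges vs es)"
proof (intro equalityI subsetI)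
  fix e assume e: "e \<in> edges (compl_graph (lgraph vs es))"
  obtain u v where uv: "e = {u, v}" "u \<in> set vs" "v \<in> set vs" "u \<noteq> v" "\<not> joined es u v"
    using compl_edgeE[OF e] by (auto simp: edge_lgraph_iff)
  have "\<not> joined es v u" using uv(5) edge_lgraph_iff insert_commute by metis
  then have "(u, v) \<in> set (non_edges vs es) \<or> (v, u) \<in> set (non_edges vs es)"
    using uv(2,3,5) uv(4)[unfolded neq_iff] by (simp add: non_edges_def)
  then show "e \<in> (\<lambda>(a, b). {a, b}) ` set (non_edges vs es)"
    using uv(1) by (metis (mono_tags, lifting) case_prod_conv imageI insert_commute)
next
  fix e assume "e \<in> (\<lambda>(a, b). {a, b}) ` set (non_edges vs es)"
  then obtain a b where ab: "e = {a, b}" "(a, b) \<in> set (non_edges vs es)" by auto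
  then show "e \<in> edges (compl_graph (lgraph vs es))"
    using compl_edgeI[of a "lgraph vs es" b] by (auto simp: non_edges_def edge_lgraph_iff)
qed

lemma proper_graphs:
  assumes "proper vs es"
  shows "lgraph vs es \<in> graphs"
proof -
  have sub: "edges (lgraph vs es) \<subseteq> all_edges (set vs)"
    using assms by (fastforce simp: proper_def lgraph_def all_edges_def list_all_iff)
  have "edges (compl_graph (lgraph vs es)) \<noteq> {}"
    using assms by (simp add: compl_edges_lgraph proper_def)
  then have "edges (lgraph vs es) \<noteq> all_edges (set vs)" by (auto simp: compl_graph_def)
  then show ?thesis
    using sub assms
    by (auto simp: graphs_def simple_graph_def complete_graph_def edgeless_def proper_def lgraph_def)
qed

context
  fixes vs :: "'a::linorder list" and es
  assumes proper: "proper vs es"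
begin

lemma distinct_vs: "distinct vs" using proper by (simp add: proper_def)

lemma del_vert_gammas:
  "(\<forall>v\<in>verts (lgraph vs es). P (gamma_R (del_vert (lgraph vs es) v))) \<longleftrightarrow>
     list_all P (del_vert_gammas vs es)"
  using distinct_vs
  by (simp add: del_vert_lgraph gamma_R_lgraph del_vert_gammas_def list_all_iff)

lemma del_edge_gammas:
  "(\<forall>e\<in>edges (lgraph vs es). P (gamma_R (del_edge (lgraph vs es) e))) \<longleftrightarrow>
     list_all P (del_edge_gammas vs es)"
proof -
  have "(\<forall>e\<in>edges (lgraph vs es). P (gamma_R (del_edge (lgraph vs es) e))) \<longleftrightarrow>
      (\<forall>(a, b)\<in>set es. P (gamma_R (del_edge (lgraph vs es) {a, b})))"
    by (subst (1) lgraph_def) auto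
  then show ?thesis
    using distinct_vs
    by (simp add: del_edge_lgraph gamma_R_lgraph del_edge_gammas_def list_all_iff case_prod_unfold)
qed

lemma add_edge_gammas:
  "(\<forall>e\<in>edges (compl_graph (lgraph vs es)). P (gamma_R (add_edge (lgraph vs es) e))) \<longleftrightarrow>
     list_all P (add_edge_gammas vs es)"
  using distinct_vs
  by (simp add: compl_edges_lgraph add_edge_gammas_def list_all_iff case_prod_unfold
      add_edge_lgraph gamma_R_lgraph)

lemma classes_lgraph:
  "lgraph vs es \<in> R_CVR \<longleftrightarrow> list_all (\<lambda>k. k < gamma_list vs es) (del_vert_gammas vs es)"
  "lgraph vs es \<in> R_UVR \<longleftrightarrow> list_all (\<lambda>k. k = gamma_list vs es) (del_vert_gammas vs es)"
  "lgraph vs es \<in> R_CER \<longleftrightarrow> list_all (\<lambda>k. gamma_list vs es < k) (del_edge_gammas vs es)"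
  "lgraph vs es \<in> R_UER \<longleftrightarrow> list_all (\<lambda>k. k = gamma_list vs es) (del_edge_gammas vs es)"
  "lgraph vs es \<in> R_CEA \<longleftrightarrow> list_all (\<lambda>k. k < gamma_list vs es) (add_edge_gammas vs es)"
  "lgraph vs es \<in> R_UEA \<longleftrightarrow> list_all (\<lambda>k. k = gamma_list vs es) (add_edge_gammas vs es)"
  using proper_graphs[OF proper] gamma_R_lgraph[OF distinct_vs, of es]
    del_vert_gammas[of "\<lambda>k. k < gamma_list vs es"] del_vert_gammas[of "\<lambda>k. k = gamma_list vs es"]
    del_edge_gammas[of "\<lambda>k. gamma_list vs es < k"] del_edge_gammas[of "\<lambda>k. k = gamma_list vs es"]
    add_edge_gammas[of "\<lambda>k. k < gamma_list vs es"] add_edge_gammas[of "\<lambda>k. k = gamma_list vs es"]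
  by (simp_all add: R_CVR_def R_UVR_def R_CER_def R_UER_def R_CEA_def R_UEA_def)

end

text \<open>All numbers on which membership in the six classes depends.\<close>

definition profile ::
  "'a::linorder list \<Rightarrow> ('a \<times> 'a) list \<Rightarrow> nat \<times> nat list \<times> nat list \<times> nat list" where
  "profile vs es = (gamma_list vs es, del_vert_gammas vs es, del_edge_gammas vs es, add_edge_gammas vs es)"

lemma classes_of_profile:
  assumes "proper vs es" "profile vs es = (g, dv, de, ae)"
  shows "lgraph vs es \<in> R_CVR \<longleftrightarrow> list_all (\<lambda>k. k < g) dv"
    "lgraph vs es \<in> R_UVR \<longleftrightarrow> list_all (\<lambda>k. k = g) dv"
    "lgraph vs es \<in> R_CER \<longleftrightarrow> list_all (\<lambda>k. g < k) de"
    "lgraph vs es \<in> R_UER \<longleftrightarrow> list_all (\<lambda>k. k = g) de"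
    "lgraph vs es \<in> R_CEA \<longleftrightarrow> list_all (\<lambda>k. k < g) ae"
    "lgraph vs es \<in> R_UEA \<longleftrightarrow> list_all (\<lambda>k. k = g) ae"
  using classes_lgraph[OF assms(1)] assms(2) by (simp_all add: profile_def)

section \<open>A witness for each region\<close>

text \<open>
  A graph on at least two vertices with a universal vertex, one adjacent to all others, has \<open>\<gamma> = 2\<close>.
  No edge can lower this, so it is in \<^const>\<open>R_UEA\<close> (when it is not complete). In the paw and the
  claw the centre 0 is the only universal vertex. Deleting it or any edge at it leaves a graph with
  \<open>\<gamma> = 3\<close>. The claw has no other edges, while the paw has one, and deleting that one changes nothing.
\<close>

definition paw :: "(nat \<times> nat) list" where
  "paw =
    [(0,1), (0,2), (0,3), (2,3)]"

lemma paw_region: "lgraph [0..<4] paw \<in> R_UEA - (R_UVR \<union> R_UER \<union> R_CER)"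
proof -
  have "proper [0..<4] paw" by code_simp
  moreover have "profile [0..<4] paw =
      (2, [3,2,2,2], [3,3,3,2], [2,2])"
    by code_simp
  ultimately show ?thesis by (simp add: classes_of_profile)
qed

text \<open>Two universal vertices: each can replace the other, and only the deletion of the edge
  between them raises \<open>\<gamma>\<close>, because then neither is universal.\<close>

definition diamond :: "(nat \<times> nat) list" where
  "diamond =
    [(0,1), (0,2), (0,3), (1,2), (1,3)]"

lemma diamond_region: "lgraph [0..<4] diamond \<in> R_UVR - (R_UER \<union> R_CER)"
proof -
  have "proper [0..<4] diamond" by code_simp
  moreover have "profile [0..<4] diamond =
      (2, [2,2,2,2], [3,2,2,2,2], [2])"
    by code_simp
  ultimately show ?thesis by (simp add: classes_of_profile)
qed

text \<open>Vertex 0 is to carry label 2 in every optimal labelling, so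
  that its deletion raises \<open>\<gamma>\<close>, and yet no single edge may matter. Its partner is any one of three hubs
  1, 2, 3, and each pair consisting of 0 and a hub dominates the graph. The vertices 7, 8, 9 are
  adjacent to all hubs, which makes the choice of the hub free and the edges between them and the hubs
  redundant. The vertices 4, 5, 6 are adjacent to 0 and to one hub each: two hubs
  alone miss one of these vertices, so 0 is needed; but if an edge at 0 is deleted, a suitable hub
  dominates its other end, and an edge between a hub and 4, 5 or 6 is redundant, as 0 dominates both
  its ends. No vertex has more than 6 neighbours, hence even after
  adding an edge a single vertex with label 2 leaves at least two vertices undominated and \<open>\<gamma>\<close> stays 4.\<close>

definition three_hubs :: "(nat \<times> nat) list" where
  "three_hubs =
    [(0,1), (0,2), (0,3), (0,4), (0,5), (0,6), (1,4), (2,5), (3,6), (1,7), (1,8),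
    (1,9), (2,7), (2,8), (2,9), (3,7), (3,8), (3,9)]"

lemma three_hubs_region: "lgraph [0..<10] three_hubs \<in> (R_UEA \<inter> R_UER) - R_UVR"
proof -
  have "proper [0..<10] three_hubs" by code_simp
  moreover have "profile [0..<10] three_hubs =
      (4, [6,4,4,4,4,4,4,4,4,4], replicate 18 4, replicate 27 4)"
    by code_simp
  ultimately show ?thesis by (simp add: classes_of_profile list_all_iff)
qed

text \<open>Three universal vertices: at least one of them survives the deletion of any edge.\<close>

definition k5_minus_edge :: "(nat \<times> nat) list" where
  "k5_minus_edge =
    [(0,1), (0,2), (0,3), (0,4), (1,2), (1,3), (1,4), (2,3), (2,4)]"

lemma k5_minus_edge_region: "lgraph [0..<5] k5_minus_edge \<in> R_UVR \<inter> R_UER"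
proof -
  have "proper [0..<5] k5_minus_edge" by code_simp
  moreover have "profile [0..<5] k5_minus_edge =
      (2, [2,2,2,2,2], [2,2,2,2,2,2,2,2,2], [2])"
    by code_simp
  ultimately show ?thesis by (simp add: classes_of_profile)
qed

text \<open>Every edge meets the only universal vertex 0, but deleting 0 leaves two isolated vertices of total
  weight 2, so no vertex deletion changes \<open>\<gamma>\<close>.\<close>

definition path3 :: "(nat \<times> nat) list" where
  "path3 =
    [(0,1), (0,2)]"

lemma path3_region: "lgraph [0..<3] path3 \<in> R_UVR \<inter> R_CER"
proof -
  have "proper [0..<3] path3" by code_simp
  moreover have "profile [0..<3] path3 =
      (2, [2,2,2], [3,3], [2])"
    by code_simp
  ultimately show ?thesis by (simp add: classes_of_profile)
qed

definition claw :: "(nat \<times> nat) list" where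
  "claw =
    [(0,1), (0,2), (0,3)]"

lemma claw_region: "lgraph [0..<4] claw \<in> (R_UEA \<inter> R_CER) - R_UVR"
proof -
  have "proper [0..<4] claw" by code_simp
  moreover have "profile [0..<4] claw =
      (2, [3,2,2,2], [3,3,3], [2,2,2])"
    by code_simp
  ultimately show ?thesis by (simp add: classes_of_profile)
qed

text \<open>An isolated vertex must have label 1 in an optimal labelling. Joining it to a vertex with label 2 lowers
  \<open>\<gamma>\<close>, as does deleting it. In the remaining graphs isolated vertices are combined with a component:
  a triangle, where no single edge matters and every vertex can carry label 2; an
  edge, whose ends are as good with labels 1 and 1; or a path on three vertices, where both edges
  matter. Two isolated vertices give a non-edge whose addition does not lower \<open>\<gamma>\<close>.\<close>

definition triangle_two_isolated :: "(nat \<times> nat) list" where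
  "triangle_two_isolated =
    [(0,1), (0,2), (1,2)]"

lemma triangle_two_isolated_region: "lgraph [0..<5] triangle_two_isolated \<in> R_UER - (R_UEA \<union> R_CVR \<union> R_CEA)"
proof -
  have "proper [0..<5] triangle_two_isolated" by code_simp
  moreover have "profile [0..<5] triangle_two_isolated =
      (4, [4,4,4,3,3], [4,4,4], [3,3,3,3,3,3,4])"
    by code_simp
  ultimately show ?thesis by (simp add: classes_of_profile)
qed

definition edge_two_isolated :: "(nat \<times> nat) list" where
  "edge_two_isolated =
    [(0,1)]"

lemma edge_two_isolated_region: "lgraph [0..<4] edge_two_isolated \<in> R_CVR - R_CEA"
proof -
  have "proper [0..<4] edge_two_isolated" by code_simp
  moreover have "profile [0..<4] edge_two_isolated =
      (4, [3,3,3,3], [4], [3,3,3,3,4])"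
    by code_simp
  ultimately show ?thesis by (simp add: classes_of_profile)
qed

definition edge_one_isolated :: "(nat \<times> nat) list" where
  "edge_one_isolated =
    [(0,1)]"

lemma edge_one_isolated_region: "lgraph [0..<3] edge_one_isolated \<in> R_CVR \<inter> R_CEA"
proof -
  have "proper [0..<3] edge_one_isolated" by code_simp
  moreover have "profile [0..<3] edge_one_isolated =
      (3, [2,2,2], [3], [2,2])"
    by code_simp
  ultimately show ?thesis by (simp add: classes_of_profile)
qed

definition triangle_one_isolated :: "(nat \<times> nat) list" where
  "triangle_one_isolated =
    [(0,1), (0,2), (1,2)]"

lemma triangle_one_isolated_region: "lgraph [0..<4] triangle_one_isolated \<in> R_CEA - R_CVR"
proof -
  have "proper [0..<4] triangle_one_isolated" by code_simp
  moreover have "profile [0..<4] triangle_one_isolated =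
      (3, [3,3,3,2], [3,3,3], [2,2,2])"
    by code_simp
  ultimately show ?thesis by (simp add: classes_of_profile)
qed

definition path3_one_isolated :: "(nat \<times> nat) list" where
  "path3_one_isolated =
    [(0,1), (0,2)]"

lemma path3_one_isolated_region: "lgraph [0..<4] path3_one_isolated \<in> R_CER - R_UEA"
proof -
  have "proper [0..<4] path3_one_isolated" by code_simp
  moreover have "profile [0..<4] path3_one_isolated =
      (3, [3,3,3,2], [4,4], [2,3,3,3])"
    by code_simp
  ultimately show ?thesis by (simp add: classes_of_profile)
qed

lemma nonempty_if_mem: "x \<in> A \<Longrightarrow> A \<noteq> {}"
  by blast

theorem theorem3:
  "((R_CEA :: 'a sgraph set) \<union> R_CVR \<subseteq> R_UER) \<and>
   ((R_UVR :: 'a sgraph set) \<subseteq> R_UEA) \<and>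
   ((R_UER :: 'a sgraph set) \<inter> R_CER = {} \<and>
    (R_UVR :: 'a sgraph set) \<inter> R_CVR = {} \<and>
    (R_UEA :: 'a sgraph set) \<inter> R_CEA = {} \<and>
    (R_CVR :: 'a sgraph set) \<inter> R_UEA = {}) \<and>
   ((R_UEA :: nat sgraph set) - (R_UVR \<union> R_UER \<union> R_CER) \<noteq> {} \<and>
    (R_UVR :: nat sgraph set) - (R_UER \<union> R_CER) \<noteq> {} \<and>
    ((R_UEA :: nat sgraph set) \<inter> R_UER) - R_UVR \<noteq> {} \<and>
    (R_UVR :: nat sgraph set) \<inter> R_UER \<noteq> {} \<and>
    (R_UVR :: nat sgraph set) \<inter> R_CER \<noteq> {} \<and>
    ((R_UEA :: nat sgraph set) \<inter> R_CER) - R_UVR \<noteq> {} \<and>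
    (R_UER :: nat sgraph set) - (R_UEA \<union> R_CVR \<union> R_CEA) \<noteq> {} \<and>
    (R_CVR :: nat sgraph set) - R_CEA \<noteq> {} \<and>
    (R_CVR :: nat sgraph set) \<inter> R_CEA \<noteq> {} \<and>
    (R_CEA :: nat sgraph set) - R_CVR \<noteq> {} \<and>
    (R_CER :: nat sgraph set) - R_UEA \<noteq> {})"
  by (intro conjI Un_least CEA_subset_UER CVR_subset_UER UVR_subset_UEA
      UER_CER_disjoint UVR_CVR_disjoint UEA_CEA_disjoint CVR_UEA_disjoint
      paw_region[THEN nonempty_if_mem] diamond_region[THEN nonempty_if_mem]
      three_hubs_region[THEN nonempty_if_mem] k5_minus_edge_region[THEN nonempty_if_mem]
      path3_region[THEN nonempty_if_mem] claw_region[THEN nonempty_if_mem]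
      triangle_two_isolated_region[THEN nonempty_if_mem]
      edge_two_isolated_region[THEN nonempty_if_mem]
      edge_one_isolated_region[THEN nonempty_if_mem]
      triangle_one_isolated_region[THEN nonempty_if_mem]
      path3_one_isolated_region[THEN nonempty_if_mem])

end
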